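(* Let $n,t\ge0$, $\nu,s\ge1$ and $0\le k\le n$ be integers, and let $\bm{t}=(t_1,\dots,t_s)$ be any sequence of non-negative integers with $t_1+\cdots+t_s=t$. Let $\mathbf 1=(1,\dots,1)$ ($s$ entries). Then the $\nu$-order generalized $(s,t)$-Ward number $W^{(\nu)}(n,k;s,t)$ counts the $(\nu+2,\bm{t}+\mathbf{1})$-ary increasing $(s,[n])$-forests $\bm{F}$ with at most $k$ ascents and $n-k$ distinguished nodes from the set $\mathcal{D}_{\bm{t}}(\bm{F})$; that is, it equals the number of pairs $(\bm{F},S)$ where $\bm{F}$ is such a forest with at most $k$ ascents and $S\subseteq\mathcal{D}_{\bm{t}}(\bm{F})$ has cardinality $n-k$.
   Context: Write $[n]=\{1,\dots,n\}$ (with $[0]=\emptyset$). **Ward numbers.** They are defined by $$W^{(\nu)}(n,k;s,t)=(k+s)\,W^{(\nu)}(n-1,k;s,t)+(\nu n+k+s+t-1-\nu)\,W^{(\nu)}(n-1,k-1;s,t)+\delta_{k0}\delta_{n0},$$ with $W^{(\nu)}(n,k;s,t)=0$ if $n<0$ or $k<0$. **Trees and forests.** For integers $d\ge2$, $d_0\ge1$ and a finite set $X$ of positive integers, a $(d,d_0)$-ary increasing $X$-tree is a rooted tree whose internal vertices are labelled bijectively by $\{0\}\cup X$, whose root is labelled $0$, such that the labels along the path from the root to any internal vertex form an increasing sequence, and such that the root has $d_0$ labelled (ordered, left to right) positions for children and every other internal vertex has $d$ labelled (ordered) positions for children; each position is occupied by an internal vertex or by an external (unlabelled leaf) node. When $d_0=1$,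 such a tree is identified with the tree obtained by deleting the root $0$: this is a $d$-ary increasing $X$-tree (internal vertices labelled by $X$, root labelled $\min X$, each internal vertex having $d$ ordered child positions, labels increasing along paths from the root), or the empty tree if $X=\emptyset$. For $\mathbf{u}=(u_1,\dots,u_s)$ with integers $u_i\ge1$, a $(d,\mathbf{u})$-ary increasing $(s,[n])$-forest is an ordered sequence $\bm{F}=(T_1,\dots,T_s)$ such that, for some ordered partition $(X_1,\dots,X_s)$ of $[n]$ into pairwise disjoint, possibly empty, subsets, each $T_i$ is a $(d,u_i)$-ary increasing $X_i$-tree. **Ascents.** The word of an external node (or of the empty tree) is empty; the word of a (sub)tree $T$ with root labelled $v$ and subtrees $S_1,\dots,S_m$ at its child positions from left to right is $w(T)=w(S_1)\,v\,w(S_2)\,v\cdots v\,w(S_m)$. (This is the generalized Stirling permutation corresponding to $T$.) The number of ascents of $T$ is the number of indices $i$ with $r_i<r_{i+1}$ in the word $w(T)=r_1r_2\cdots$, and the number of ascents of $\bm{F}=(T_1,\dots,T_s)$ is the sum of the numbers of ascents of the $T_i$. **The sets $\mathcal{D}$.** For a tree $T$, $\mathcal{E}(T)$ is the set of internal nodes of $T$ that are the first (leftmost) children of their respective parents. For a $(\nu+2,t_i+1)$-ary increasing $X_i$-tree $T_i$: if $t_i>0$, $\mathcal{D}_{t_i}(T_i)=\mathcal{E}(T_i)$; if $t_i=0$, regard $T_i$ as a $(\nu+2)$-ary increasing $X_i$-tree (the empty tree if $X_i=\emptyset$) by deleting its root $0$, which has a single child position, and keeping the subtree at that position, and let $\mathcal{D}_0(T_i)$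 be the union of $\mathcal{E}(T_i)$ and the set consisting of the root of $T_i$, both taken in the tree after this deletion (so $\mathcal{D}_0(T_i)=\emptyset$ if $X_i=\emptyset$). Finally $\mathcal{D}_{\bm{t}}(\bm{F})=\bigcup_{i=1}^s\mathcal{D}_{t_i}(T_i)$. *)

theory Defs
  imports Main "HOL-Library.Disjoint_Sets"
begin

function ward :: "int \<Rightarrow> int \<Rightarrow> int \<Rightarrow> int \<Rightarrow> int \<Rightarrow> int" where
  "ward \<nu> n k s t =
    (if n < 0 \<or> k < 0 then 0
     else (k + s) * ward \<nu> (n - 1) k s t
        + (\<nu> * n + k + s + t - 1 - \<nu>) * ward \<nu> (n - 1) (k - 1) s t
        + (if k = 0 \<and> n = 0 then 1 else 0))"
  by pat_completeness auto
termination
  by (relation "measure (\<lambda>(\<nu>, n, k, s, t). nat (n + 1))") auto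

declare ward.simps [simp del]

text \<open>The list in \<open>Node v Ts\<close> gives the contents of the child positions of the internal vertex
  labelled \<open>v\<close>, from left to right; a position holding no internal vertex holds \<open>External\<close>,
  which also represents the empty tree.\<close>

datatype itree = External | Node nat "itree list"

fun labels :: "itree \<Rightarrow> nat list" where
  "labels External = []"
| "labels (Node v Ts) = v # concat (map labels Ts)"

text \<open>The label sequences of the paths from the root to each internal vertex.\<close>

fun root_paths :: "itree \<Rightarrow> nat list set" where
  "root_paths External = {}"
| "root_paths (Node v Ts) = insert [v] (\<Union>T\<in>set Ts. (\<lambda>p. v # p) ` root_paths T)"

definition increasing :: "itree \<Rightarrow> bool" where
  "increasing T \<longleftrightarrow> (\<forall>p\<in>root_paths T. sorted_wrt (<) p)"

fun dary :: "nat \<Rightarrow> itree \<Rightarrow> bool" where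
  "dary d External \<longleftrightarrow> True"
| "dary d (Node v Ts) \<longleftrightarrow> length Ts = d \<and> (\<forall>T\<in>set Ts. dary d T)"

text \<open>The \<open>(d, d0)\<close>-ary increasing \<open>X\<close>-trees. The root \<open>0\<close> is kept also when \<open>d0 = 1\<close>; the
  identification with the tree below it is a bijection (see \<open>delete_root\<close>) and does not affect
  the word, in which a root with a single child position does not occur.\<close>

definition increasing_trees :: "nat \<Rightarrow> nat \<Rightarrow> nat set \<Rightarrow> itree set" where
  "increasing_trees d d0 X =
    {T. (\<exists>Ts. T = Node 0 Ts \<and> length Ts = d0 \<and> (\<forall>S\<in>set Ts. dary d S))
      \<and> distinct (labels T) \<and> set (labels T) = {0} \<union> X \<and> increasing T}"

definition increasing_forests :: "nat \<Rightarrow> nat list \<Rightarrow> nat \<Rightarrow> itree list set" where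
  "increasing_forests d us n =
    {F. length F = length us \<and>
      (\<exists>X. (\<Union>i<length us. X i) = {1..n} \<and> disjoint_family_on X {..<length us}
         \<and> (\<forall>i<length us. F ! i \<in> increasing_trees d (us ! i) (X i)))}"

text \<open>\<open>join v [w\<^sub>1, \<dots>, w\<^sub>m] = w\<^sub>1 v w\<^sub>2 v \<dots> v w\<^sub>m\<close>, with \<open>m - 1\<close> occurrences of the separator \<open>v\<close>.\<close>

fun join :: "'a \<Rightarrow> 'a list list \<Rightarrow> 'a list" where
  "join v [] = []"
| "join v [w] = w"
| "join v (w # w' # ws) = w @ v # join v (w' # ws)"

fun word :: "itree \<Rightarrow> nat list" where
  "word External = []"
| "word (Node v Ts) = join v (map word Ts)"

definition tree_ascents :: "itree \<Rightarrow> nat" where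
  "tree_ascents T = card {i. Suc i < length (word T) \<and> word T ! i < word T ! Suc i}"

definition forest_ascents :: "itree list \<Rightarrow> nat" where
  "forest_ascents F = (\<Sum>T\<leftarrow>F. tree_ascents T)"

text \<open>In what follows a set of internal nodes is given by the set of their labels. This is
  unambiguous: labels within an increasing tree are distinct, and in an increasing forest only the
  label \<open>0\<close> of the roots is shared, which never belongs to a set \<open>\<D>\<close>.\<close>

fun root_nodes :: "itree \<Rightarrow> nat set" where
  "root_nodes External = {}"
| "root_nodes (Node v Ts) = {v}"

fun first_children :: "itree \<Rightarrow> nat set" where
  "first_children External = {}"
| "first_children (Node v Ts) =
    (case Ts of [] \<Rightarrow> {} | T # _ \<Rightarrow> root_nodes T) \<union> (\<Union>T\<in>set Ts. first_children T)"

text \<open>Only used for trees whose root has exactly one child position.\<close>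

fun delete_root :: "itree \<Rightarrow> itree" where
  "delete_root (Node v (T # Ts)) = T"
| "delete_root T = T"

definition tree_D :: "nat \<Rightarrow> itree \<Rightarrow> nat set" where
  "tree_D u T =
    (if u > 0 then first_children T
     else first_children (delete_root T) \<union> root_nodes (delete_root T))"

definition forest_D :: "nat list \<Rightarrow> itree list \<Rightarrow> nat set" where
  "forest_D us F = (\<Union>i<length us. tree_D (us ! i) (F ! i))"

end

theory Submission
  imports Defs "HOL-Library.Multiset"
begin

text \<open>
  In an increasing tree all labels below a vertex \<open>v\<close> exceed \<open>v\<close>. In the word of the tree, the word
  of every subtree of \<open>v\<close> but the leftmost is preceded by \<open>v\<close>, and the letter after the word of a
  subtree, if there is one, belongs to an ancestor and is smaller. Hence every internal vertex that is a child of
  its parent but not the first one contributes exactly one ascent, namely the step that enters its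
  word, and there are no other ascents. This makes \<open>tree_ascents\<close> the purely structural statistic
  \<open>later_children\<close> (\<open>forest_ascents_eq\<close>). The sets \<open>\<D>\<close> consist of the remaining non-root vertices,
  the first children; the special rule for \<open>t\<^sub>i = 0\<close> says the same for the tree whose root \<open>0\<close> has
  been kept. Therefore a forest on \<open>{1..n}\<close> with \<open>j\<close> ascents has exactly \<open>n - j\<close> vertices in
  \<open>\<D>\<close> (\<open>card_forest_D\<close>), and the pairs of the theorem are counted by the sum of
  \<open>n - j choose n - k\<close> over all forests with \<open>j \<le> k\<close>.

  Every forest on \<open>{1..n + 1}\<close> arises from a unique forest on \<open>{1..n}\<close> by grafting a vertex
  \<open>n + 1\<close> at an external position: the largest label sits on a vertex without internal children,
  so it can be pruned again (\<open>increasing_forests_Suc\<close>, \<open>prune_graft_forest\<close>). A forest on \<open>{1..n}\<close> has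
  \<open>(\<nu> + 1) n + s + t\<close> external positions. If it has \<open>j\<close> ascents, then \<open>j + s\<close> of these
  positions are first ones: each of them ends a unique maximal path along first child positions, and
  the starting points of these paths are the \<open>s\<close> roots and the \<open>j\<close> internal vertices that are
  later children. Grafting there leaves \<open>j\<close> unchanged, and grafting at any other position
  increases it to \<open>j + 1\<close> (\<open>sum_later_children_graft_forest\<close>).

  The sum of the binomial coefficients above thus satisfies a recurrence in \<open>n\<close>, and Pascal's rule
  together with the absorption identity turns it, for each forest separately, into the recurrence of
  the Ward numbers (\<open>pair_weight_Suc\<close>, \<open>ward_eq_sum_pair_weight\<close>).
\<close>

section \<open>Replacing one entry of a list\<close>

text \<open>Choosing an external position of a tree or of a forest means choosing a member of a list
  of trees and then a position inside it; this combinator expresses that choice for the children of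
  a vertex and for the components of a forest alike.\<close>

fun replace_one :: "('a \<Rightarrow> 'a list) \<Rightarrow> 'a list \<Rightarrow> 'a list list" where
  "replace_one f [] = []"
| "replace_one f (x # xs) = map (\<lambda>y. y # xs) (f x) @ map ((#) x) (replace_one f xs)"

lemma replace_one_cong [fundef_cong]:
  assumes "xs = ys" and "\<And>x. x \<in> set ys \<Longrightarrow> f x = g x"
  shows "replace_one f xs = replace_one g ys"
  using assms(2) unfolding assms(1) by (induction ys) auto

lemma in_set_replace_one_iff:
  "zs \<in> set (replace_one f xs) \<longleftrightarrow>
    (\<exists>us x y vs. xs = us @ x # vs \<and> y \<in> set (f x) \<and> zs = us @ y # vs)"
proof (induction xs arbitrary: zs)
  case (Cons a xs)
  note IH = Cons.IH
  show ?case (is "?L \<longleftrightarrow> ?R")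
  proof
    assume ?L
    then consider y where "y \<in> set (f a)" "zs = y # xs"
      | zs' where "zs' \<in> set (replace_one f xs)" "zs = a # zs'"
      by auto
    then show ?R
    proof cases
      case 1
      then show ?thesis by (metis append_Nil)
    next
      case 2
      then show ?thesis using Cons.IH by (metis append_Cons)
    qed
  next
    assume ?R
    then obtain us x y vs where *: "a # xs = us @ x # vs" "y \<in> set (f x)" "zs = us @ y # vs"
      by blast
    show ?L
    proof (cases us)
      case Nil
      then show ?thesis using * by auto
    next
      case (Cons b us')
      then have "us' @ y # vs \<in> set (replace_one f xs)"
        using IH * by auto
      then show ?thesis using * Cons by auto
    qed
  qed
qed auto

lemma distinct_replace_one:
  assumes "\<And>x. x \<in> set xs \<Longrightarrow> distinct (f x) \<and> x \<notin> set (f x)"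
  shows "distinct (replace_one f xs)"
  using assms by (induction xs) (auto simp: distinct_map inj_on_def)

lemma length_replace_one: "length (replace_one f xs) = (\<Sum>x\<leftarrow>xs. length (f x))"
  by (induction xs) auto

text \<open>Transfers to lists the property that among the replacements of \<open>x\<close> exactly \<open>h x + c\<close> keep the
  statistic \<open>h\<close> and all others raise it by one. It is phrased as the expansion of sums of an arbitrary
  \<open>g\<close>, because instantiating \<open>g\<close> with its own translates lets the other entries of the list add
  their constant contribution.\<close>

lemma sum_list_replace_one:
  fixes h :: "'a \<Rightarrow> nat" and g :: "nat \<Rightarrow> int"
  assumes "\<And>x g. x \<in> set xs \<Longrightarrow> (\<Sum>y\<leftarrow>f x. g (h y)) =
    int (h x + c) * g (h x) + (int (length (f x)) - int (h x + c)) * g (Suc (h x))"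
  shows "(\<Sum>ys\<leftarrow>replace_one f xs. g (\<Sum>y\<leftarrow>ys. h y)) =
    int ((\<Sum>x\<leftarrow>xs. h x) + c * length xs) * g (\<Sum>x\<leftarrow>xs. h x)
    + (int (length (replace_one f xs)) - int ((\<Sum>x\<leftarrow>xs. h x) + c * length xs))
      * g (Suc (\<Sum>x\<leftarrow>xs. h x))"
  using assms
proof (induction xs arbitrary: g)
  case (Cons a xs)
  let ?H = "\<Sum>x\<leftarrow>xs. h x"
  have IH: "(\<Sum>ys\<leftarrow>replace_one f xs. g (h a + (\<Sum>y\<leftarrow>ys. h y))) =
    int (?H + c * length xs) * g (h a + ?H)
    + (int (length (replace_one f xs)) - int (?H + c * length xs)) * g (Suc (h a + ?H))"
    using Cons.IH[of "\<lambda>m. g (h a + m)"] Cons.prems by simp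
  have hd: "(\<Sum>y\<leftarrow>f a. g (h y + ?H)) =
    int (h a + c) * g (h a + ?H) + (int (length (f a)) - int (h a + c)) * g (Suc (h a + ?H))"
    using Cons.prems[of a "\<lambda>m. g (m + ?H)"] by simp
  show ?case
    using IH hd by (simp add: comp_def algebra_simps)
qed auto

section \<open>Ascents are internal vertices that are later children\<close>

text \<open>The structural form of the number of ascents. The root of the tree itself is not counted, as
  no smaller letter precedes its word; hence the correction by \<open>of_bool\<close> when the tree
  becomes a later child of another vertex.\<close>

fun later_children :: "itree \<Rightarrow> nat" where
  "later_children External = 0"
| "later_children (Node v []) = 0"
| "later_children (Node v (T # Ts)) =
    later_children T + (\<Sum>S\<leftarrow>Ts. later_children S + of_bool (S \<noteq> External))"

definition word_ascents :: "nat list \<Rightarrow> nat" where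
  "word_ascents w = card {i. Suc i < length w \<and> w ! i < w ! Suc i}"

lemma word_ascents_simps [simp]:
  "word_ascents [] = 0"
  "word_ascents [a] = 0"
  "word_ascents (a # b # w) = of_bool (a < b) + word_ascents (b # w)"
proof -
  define A where "A = {i. Suc i < length (b # w) \<and> (b # w) ! i < (b # w) ! Suc i}"
  have "finite A"
    unfolding A_def by (rule finite_subset[of _ "{..<length (b # w)}"]) auto
  have "{i. Suc i < length (a # b # w) \<and> (a # b # w) ! i < (a # b # w) ! Suc i}
      = (if a < b then {0} else {}) \<union> Suc ` A" (is "?B = _")
  proof (rule set_eqI)
    fix i
    show "i \<in> ?B \<longleftrightarrow> i \<in> (if a < b then {0} else {}) \<union> Suc ` A"
      by (cases i) (auto simp: A_def image_iff)
  qed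
  also have "card \<dots> = of_bool (a < b) + card A"
    using \<open>finite A\<close> by (simp add: card_image card_insert_if image_iff)
  finally show "word_ascents (a # b # w) = of_bool (a < b) + word_ascents (b # w)"
    by (simp add: word_ascents_def A_def)
qed (simp_all add: word_ascents_def)

lemma word_ascents_append: "word_ascents (u @ v # w) = word_ascents (u @ [v]) + word_ascents (v # w)"
proof (induction u)
  case (Cons a u)
  then show ?case by (cases u) auto
qed simp

lemma word_ascents_snoc_lower:
  "\<forall>a\<in>set u. v < a \<Longrightarrow> word_ascents (u @ [v]) = word_ascents u"
proof (induction u)
  case (Cons a u)
  then show ?case by (cases u) auto
qed simp

lemma word_ascents_Cons_lower:
  "\<forall>a\<in>set w. v < a \<Longrightarrow> word_ascents (v # w) = word_ascents w + of_bool (w \<noteq> [])"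
  by (cases w) auto

text \<open>Behind a \<open>v\<close>, each nonempty block of larger letters is entered by an ascent, and the step back
  to the next \<open>v\<close> is a descent.\<close>

lemma word_ascents_Cons_join:
  assumes "ws \<noteq> []" and "\<forall>w\<in>set ws. \<forall>a\<in>set w. v < a"
  shows "word_ascents (v # join v ws) = (\<Sum>w\<leftarrow>ws. word_ascents w + of_bool (w \<noteq> []))"
  using assms
proof (induction v ws rule: join.induct)
  case (3 v w w' ws)
  have "word_ascents (v # join v (w # w' # ws))
      = word_ascents ((v # w) @ [v]) + word_ascents (v # join v (w' # ws))"
    using word_ascents_append[of "v # w" v "join v (w' # ws)"] by simp
  also have "word_ascents ((v # w) @ [v]) = word_ascents w + of_bool (w \<noteq> [])"
    using 3 word_ascents_Cons_lower[of w v] word_ascents_snoc_lower[of w v]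
    by (cases w) auto
  finally show ?case using 3 by simp
qed (auto simp: word_ascents_Cons_lower)

lemma word_ascents_join:
  assumes "\<forall>u\<in>set (w # ws). \<forall>a\<in>set u. v < a"
  shows "word_ascents (join v (w # ws)) =
    word_ascents w + (\<Sum>u\<leftarrow>ws. word_ascents u + of_bool (u \<noteq> []))"
proof (cases ws)
  case (Cons w' ws')
  then show ?thesis
    using assms word_ascents_append[of w v "join v ws"] word_ascents_snoc_lower[of w v]
      word_ascents_Cons_join[of ws v]
    by simp
qed simp

text \<open>A form of \<open>increasing\<close> that follows the recursion of trees and bounds all labels of the
  subtrees, not only those on a given path.\<close>

fun heap_ordered :: "itree \<Rightarrow> bool" where
  "heap_ordered External \<longleftrightarrow> True"
| "heap_ordered (Node v Ts) \<longleftrightarrow>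
    (\<forall>T\<in>set Ts. heap_ordered T \<and> (\<forall>y\<in>set (labels T). v < y))"

lemma labels_eq_Nil_iff [simp]: "labels T = [] \<longleftrightarrow> T = External"
  by (cases T) auto

lemma set_in_root_path: "p \<in> root_paths T \<Longrightarrow> set p \<subseteq> set (labels T)"
  by (induction T arbitrary: p) (simp, auto, blast)

lemma label_in_root_path: "y \<in> set (labels T) \<Longrightarrow> \<exists>p\<in>root_paths T. y \<in> set p"
proof (induction T)
  case (Node v Ts)
  show ?case
  proof (cases "y = v")
    case False
    then obtain T where "T \<in> set Ts" "y \<in> set (labels T)"
      using Node.prems by auto
    then show ?thesis using Node.IH[of T] by auto
  qed simp
qed simp

lemma increasing_iff_heap_ordered: "increasing T \<longleftrightarrow> heap_ordered T"
proof (induction T)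
  case (Node v Ts)
  have "increasing (Node v Ts) \<longleftrightarrow>
      (\<forall>T\<in>set Ts. \<forall>p\<in>root_paths T. sorted_wrt (<) p \<and> (\<forall>y\<in>set p. v < y))"
    by (auto simp: increasing_def)
  also have "\<dots> \<longleftrightarrow> (\<forall>T\<in>set Ts. increasing T \<and> (\<forall>y\<in>set (labels T). v < y))"
    unfolding increasing_def
    using set_in_root_path label_in_root_path by blast
  finally show ?case using Node by simp
qed (simp add: increasing_def)

lemma set_join: "set (join v ws) \<subseteq> insert v (\<Union>w\<in>set ws. set w)"
  by (induction v ws rule: join.induct) auto

lemma set_word: "set (word T) \<subseteq> set (labels T)"
proof (induction T)
  case (Node v Ts)
  then show ?case using set_join[of v "map word Ts"] by fastforce
qed simp

lemma word_eq_Nil_iff: "dary d T \<Longrightarrow> 2 \<le> d \<Longrightarrow> word T = [] \<longleftrightarrow> T = External"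
proof (cases T)
  case (Node v Ts)
  assume "dary d T" "2 \<le> d"
  then obtain A B Cs where "Ts = A # B # Cs"
    using Node by (cases Ts; cases "tl Ts") auto
  then show ?thesis using Node by simp
qed simp

text \<open>Separate from the induction below because the root of a planted tree has another number of
  child positions than the other vertices. Having \<open>2 \<le> d\<close> ensures that the word of an internal child is
  nonempty, so that the ascent into it exists.\<close>

lemma word_ascents_Node:
  assumes "2 \<le> d" and "\<forall>T\<in>set Ts. dary d T" and "heap_ordered (Node v Ts)"
    and IH: "\<And>T. T \<in> set Ts \<Longrightarrow> word_ascents (word T) = later_children T"
  shows "word_ascents (word (Node v Ts)) = later_children (Node v Ts)"
proof (cases Ts)
  case (Cons S Ss)
  have "word_ascents (word (Node v Ts)) = word_ascents (word S)
      + (\<Sum>u\<leftarrow>map word Ss. word_ascents u + of_bool (u \<noteq> []))"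
    unfolding word.simps Cons list.map
    using assms(3) set_word Cons by (intro word_ascents_join) fastforce
  also have "\<dots> = later_children S + (\<Sum>T\<leftarrow>Ss. later_children T + of_bool (T \<noteq> External))"
    using IH assms(1,2) Cons
    by (auto simp: comp_def word_eq_Nil_iff[OF _ assms(1)] intro!: arg_cong[where f = sum_list])
  finally show ?thesis using Cons by simp
qed simp

lemma word_ascents_dary:
  assumes "2 \<le> d" and "dary d T" and "heap_ordered T"
  shows "word_ascents (word T) = later_children T"
  using assms(2,3)
proof (induction T)
  case (Node v Ts)
  then show ?case using assms(1) by (intro word_ascents_Node) auto
qed simp

lemma set_tl_labels: "set (tl (labels T)) \<subseteq> set (labels T)"
  by (cases T) auto

text \<open>The root is never a first child; dropping it is what makes the root of a leftmost subtree
  distinct from all first children inside that subtree.\<close>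

lemma first_children_subset: "first_children T \<subseteq> set (tl (labels T))"
proof (induction T)
  case (Node v Ts)
  have "(\<Union>T\<in>set Ts. first_children T) \<subseteq> (\<Union>T\<in>set Ts. set (labels T))"
    using Node set_tl_labels by (intro UN_mono order_refl) blast
  moreover have "root_nodes T \<subseteq> set (labels T)" for T
    by (cases T) auto
  ultimately show ?case by (auto split: list.splits)
qed simp

lemma finite_first_children [simp]: "finite (first_children T)"
  using first_children_subset finite_subset by blast

lemma finite_root_nodes [simp]: "finite (root_nodes T)"
  by (cases T) auto

lemma card_UN_first_children:
  assumes "distinct (concat (map labels Ts))"
  shows "card (\<Union>T\<in>set Ts. first_children T) = (\<Sum>T\<leftarrow>Ts. card (first_children T))"
  using assms
proof (induction Ts)
  case (Cons T Ts)
  have sub: "first_children S \<subseteq> set (labels S)" for S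
    using first_children_subset set_tl_labels by (rule order_trans)
  then have "(\<Union>T\<in>set Ts. first_children T) \<subseteq> set (concat (map labels Ts))"
    by auto
  moreover have "set (labels T) \<inter> set (concat (map labels Ts)) = {}"
    using Cons.prems by simp
  ultimately have "first_children T \<inter> (\<Union>T\<in>set Ts. first_children T) = {}"
    using sub[of T] by blast
  then show ?case using Cons by (simp add: card_Un_disjoint)
qed simp

text \<open>Every internal vertex is the root, a first child or a later child.\<close>

lemma card_first_children:
  assumes "distinct (labels T)"
  shows "card (first_children T) + later_children T + of_bool (T \<noteq> External) = length (labels T)"
  using assms
proof (induction T)
  case (Node v Ts)
  show ?case
  proof (cases Ts)
    case (Cons S Ss)
    let ?U = "\<Union>T\<in>set Ts. first_children T"
    have dist: "distinct (concat (map labels Ts))"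
      using Node.prems by simp
    have IH: "card (first_children T) + (later_children T + of_bool (T \<noteq> External))
        = length (labels T)" if "T \<in> set Ts" for T
    proof -
      have "distinct (labels T)"
        using that dist by (auto simp: distinct_concat_iff)
      then show ?thesis
        using Node.IH[OF that] by simp
    qed
    have "root_nodes S \<inter> ?U = {}"
    proof (cases S)
      case S: (Node r Rs)
      have "r \<notin> first_children S"
        using dist first_children_subset[of S] by (auto simp: Cons S)
      moreover have "r \<notin> first_children T" if "T \<in> set Ss" for T
      proof
        assume "r \<in> first_children T"
        then have "r \<in> set (labels T)"
          using first_children_subset set_tl_labels by blast
        then show False using dist that by (auto simp: Cons S)
      qed
      ultimately show ?thesis by (auto simp: Cons S)
    qed simp
    moreover have "card (root_nodes S) = of_bool (S \<noteq> External)"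
      by (cases S) auto
    ultimately have "card (first_children (Node v Ts))
        = of_bool (S \<noteq> External) + (\<Sum>T\<leftarrow>Ts. card (first_children T))"
      using card_UN_first_children[OF dist] by (simp add: Cons card_Un_disjoint)
    then have "card (first_children (Node v Ts)) + later_children (Node v Ts)
        = (\<Sum>T\<leftarrow>Ts. card (first_children T) + (later_children T + of_bool (T \<noteq> External)))"
      by (simp add: Cons sum_list_addf)
    also have "\<dots> = (\<Sum>T\<leftarrow>Ts. length (labels T))"
      by (intro arg_cong[where f = sum_list] map_cong refl IH)
    finally show ?thesis by (simp add: length_concat comp_def)
  qed simp
qed simp

section \<open>Grafting and pruning the vertex with the largest label\<close>

text \<open>A list instead of a set, so that its length is the number of external positions and a sum over
  it is a sum over these positions.\<close>

fun graft :: "nat \<Rightarrow> nat \<Rightarrow> itree \<Rightarrow> itree list" where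
  "graft d x External = [Node x (replicate d External)]"
| "graft d x (Node v Ts) = map (Node v) (replace_one (graft d x) Ts)"

fun prune :: "nat \<Rightarrow> itree \<Rightarrow> itree" where
  "prune x External = External"
| "prune x (Node v Ts) = (if v = x then External else Node v (map (prune x) Ts))"

lemma mset_labels_graft:
  "T' \<in> set (graft d x T) \<Longrightarrow> mset (labels T') = add_mset x (mset (labels T))"
proof (induction T arbitrary: T')
  case (Node v Ts)
  then obtain us T T'' vs where *: "Ts = us @ T # vs" "T'' \<in> set (graft d x T)"
    "T' = Node v (us @ T'' # vs)"
    by (auto simp: in_set_replace_one_iff)
  then show ?case using Node.IH[of T T''] by simp
qed (induction d, auto)

lemma set_labels_graft: "T' \<in> set (graft d x T) \<Longrightarrow> set (labels T') = insert x (set (labels T))"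
  by (metis mset_labels_graft set_mset_add_mset_insert set_mset_mset)

lemma dary_graft: "T' \<in> set (graft d x T) \<Longrightarrow> dary d T \<Longrightarrow> dary d T'"
proof (induction T arbitrary: T')
  case (Node v Ts)
  then obtain us T T'' vs where *: "Ts = us @ T # vs" "T'' \<in> set (graft d x T)"
    "T' = Node v (us @ T'' # vs)"
    by (auto simp: in_set_replace_one_iff)
  then show ?case using Node.IH[of T T''] Node.prems(2) by simp
qed auto

lemma heap_ordered_graft:
  "T' \<in> set (graft d x T) \<Longrightarrow> heap_ordered T \<Longrightarrow> \<forall>y\<in>set (labels T). y < x \<Longrightarrow> heap_ordered T'"
proof (induction T arbitrary: T')
  case (Node v Ts)
  then obtain us T T'' vs where *: "Ts = us @ T # vs" "T'' \<in> set (graft d x T)"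
    "T' = Node v (us @ T'' # vs)"
    by (auto simp: in_set_replace_one_iff)
  then show ?case
    using Node.IH[of T T''] Node.prems(2,3) set_labels_graft[of T'' d x T] by auto
qed auto

lemma dary_prune: "dary d T \<Longrightarrow> dary d (prune x T)"
  by (induction T) auto

lemma set_labels_prune: "set (labels (prune x T)) \<subseteq> set (labels T)"
  by (induction T) (simp, auto)

lemma heap_ordered_prune: "heap_ordered T \<Longrightarrow> heap_ordered (prune x T)"
proof (induction T)
  case (Node v Ts)
  have "\<forall>y\<in>set (labels (prune x T)). v < y" if "T \<in> set Ts" for T
    using Node.prems that set_labels_prune[of x T] by auto
  then show ?case using Node by auto
qed simp

lemma prune_fresh: "x \<notin> set (labels T) \<Longrightarrow> prune x T = T"
  by (induction T) (auto intro: map_idI)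

lemma prune_graft: "T' \<in> set (graft d x T) \<Longrightarrow> x \<notin> set (labels T) \<Longrightarrow> prune x T' = T"
  by (induction T arbitrary: T') (auto simp: in_set_replace_one_iff prune_fresh intro!: map_idI)

lemma not_in_graft: "T \<notin> set (graft d x T)"
proof
  assume "T \<in> set (graft d x T)"
  from mset_labels_graft[OF this] show False by simp
qed

lemma distinct_graft: "distinct (graft d x T)"
  by (induction T) (auto simp: distinct_map inj_on_def not_in_graft intro!: distinct_replace_one)

text \<open>The second assumption is the same statement for a single tree, so that this step serves the
  subtrees of an ordinary vertex, those of a planted root, and the components of a forest.\<close>

lemma in_graft_forest_prune:
  assumes "count (mset (concat (map labels Ts))) x = 1"
    and "\<And>T. T \<in> set Ts \<Longrightarrow> count (mset (labels T)) x = 1 \<Longrightarrow> T \<in> set (graft d x (prune x T))"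
  shows "Ts \<in> set (replace_one (graft d x) (map (prune x) Ts))"
  using assms
proof (induction Ts)
  case (Cons T Ts)
  show ?case
  proof (cases "x \<in> set (labels T)")
    case True
    then have "count (mset (labels T)) x > 0"
      by (simp only: count_greater_zero_iff set_mset_mset)
    moreover have "count (mset (labels T)) x + count (mset (concat (map labels Ts))) x = 1"
      using Cons.prems(1) by simp
    ultimately have 1: "count (mset (labels T)) x = 1"
      and "count (mset (concat (map labels Ts))) x = 0"
      by linarith+
    then have 0: "x \<notin> set (concat (map labels Ts))"
      by (simp only: count_eq_zero_iff set_mset_mset not_False_eq_True)
    have "map (prune x) Ts = Ts"
      using 0 by (auto intro!: map_idI prune_fresh)
    then show ?thesis using Cons.prems(2)[of T] 1 by auto
  next
    case False
    then have "count (mset (labels T)) x = 0"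
      by (simp only: count_eq_zero_iff set_mset_mset not_False_eq_True)
    moreover have "count (mset (labels T)) x + count (mset (concat (map labels Ts))) x = 1"
      using Cons.prems(1) by simp
    ultimately have "count (mset (concat (map labels Ts))) x = 1"
      by linarith
    then have "Ts \<in> set (replace_one (graft d x) (map (prune x) Ts))"
      using Cons.prems(2) by (intro Cons.IH) auto
    then show ?thesis
      using False by (simp add: prune_fresh)
  qed
qed simp

text \<open>A vertex carrying the maximal label of an increasing tree has external children only, hence it is
  exactly what a graft creates.\<close>

lemma in_graft_prune:
  assumes "count (mset (labels T)) x = 1" and "dary d T" and "heap_ordered T"
    and "\<forall>y\<in>set (labels T). y \<le> x"
  shows "T \<in> set (graft d x (prune x T))"
  using assms
proof (induction T)
  case (Node v Ts)
  show ?case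
  proof (cases "v = x")
    case True
    have "T = External" if "T \<in> set Ts" for T
    proof (rule ccontr)
      assume "T \<noteq> External"
      then obtain y where "y \<in> set (labels T)"
        by (metis labels_eq_Nil_iff list.set_sel(1))
      then show False
        using that Node.prems(3,4) True by fastforce
    qed
    then have "Ts = replicate d External"
      using Node.prems(2) by (auto simp: list_eq_iff_nth_eq)
    then show ?thesis using True by simp
  next
    case False
    have "Ts \<in> set (replace_one (graft d x) (map (prune x) Ts))"
      using Node False by (intro in_graft_forest_prune) auto
    then show ?thesis using False by simp
  qed
qed simp

text \<open>Each graft uses up one external position and creates \<open>d\<close> new ones.\<close>

lemma length_graft_dary:
  assumes "1 \<le> d" and "dary d T"
  shows "length (graft d x T) = (d - 1) * length (labels T) + 1"
  using assms(2)
proof (induction T)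
  case (Node v Ts)
  have "length (graft d x (Node v Ts)) = (\<Sum>T\<leftarrow>Ts. (d - 1) * length (labels T) + 1)"
    using Node by (auto simp: length_replace_one intro!: arg_cong[where f = sum_list])
  also have "\<dots> = (d - 1) * length (concat (map labels Ts)) + d"
    using Node.prems
    by (simp add: sum_list_Suc sum_list_const_mult length_concat comp_def)
  finally show ?case using assms(1) by simp
qed simp

text \<open>Among the external positions of a tree \<open>T\<close>, exactly \<open>later_children T + 1\<close> are such that the
  grafted vertex becomes a first child (or replaces the empty tree). In the leftmost subtree the
  claim is applied as it is. A subtree \<open>S\<close> at another position contributes
  \<open>later_children S + of_bool (S \<noteq> External)\<close>: an external one is turned into a later child by its
  only graft, while an internal one has one more position that keeps its contribution than
  \<open>later_children S\<close>, which the added \<open>1\<close> accounts for. So this statistic has shift \<open>c = 0\<close>.\<close>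

lemma sum_later_children_graft_Node:
  fixes g :: "nat \<Rightarrow> int"
  assumes "Ts \<noteq> []"
    and IH: "\<And>T g. T \<in> set Ts \<Longrightarrow> (\<Sum>T'\<leftarrow>graft d x T. g (later_children T')) =
      int (later_children T + 1) * g (later_children T)
      + (int (length (graft d x T)) - int (later_children T + 1)) * g (Suc (later_children T))"
  shows "(\<Sum>T'\<leftarrow>graft d x (Node v Ts). g (later_children T')) =
    int (later_children (Node v Ts) + 1) * g (later_children (Node v Ts))
    + (int (length (graft d x (Node v Ts))) - int (later_children (Node v Ts) + 1))
      * g (Suc (later_children (Node v Ts)))"
proof -
  obtain S Ss where Ts: "Ts = S # Ss"
    using assms(1) by (cases Ts) auto
  let ?h = "\<lambda>T. later_children T + of_bool (T \<noteq> External)"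
  let ?H = "\<Sum>T\<leftarrow>Ss. ?h T"
  have first: "(\<Sum>S'\<leftarrow>graft d x S. g (later_children S' + ?H)) =
      int (later_children S + 1) * g (later_children S + ?H)
      + (int (length (graft d x S)) - int (later_children S + 1)) * g (Suc (later_children S + ?H))"
    using IH[of S "\<lambda>m. g (m + ?H)"] Ts by simp
  have step: "(\<Sum>T'\<leftarrow>graft d x T. f (?h T')) =
      int (?h T + 0) * f (?h T) + (int (length (graft d x T)) - int (?h T + 0)) * f (Suc (?h T))"
    if "T \<in> set Ss" for T and f :: "nat \<Rightarrow> int"
  proof (cases T)
    case External
    have "later_children (Node x (replicate d External)) = 0"
      by (cases d) (auto simp: sum_list_triv map_replicate)
    then show ?thesis using External by simp
  next
    case (Node r Rs)
    have "T' \<noteq> External" if "T' \<in> set (graft d x T)" for T'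
      using set_labels_graft[OF that] by auto
    then have "(\<Sum>T'\<leftarrow>graft d x T. f (?h T')) = (\<Sum>T'\<leftarrow>graft d x T. f (Suc (later_children T')))"
      by (auto intro!: arg_cong[where f = sum_list])
    then show ?thesis
      using IH[of T "\<lambda>m. f (Suc m)"] that Ts Node by simp
  qed
  have rest: "(\<Sum>Ss'\<leftarrow>replace_one (graft d x) Ss. g (later_children S + (\<Sum>T\<leftarrow>Ss'. ?h T))) =
      int ?H * g (later_children S + ?H)
      + (int (length (replace_one (graft d x) Ss)) - int ?H) * g (Suc (later_children S + ?H))"
    using sum_list_replace_one[where xs = Ss and f = "graft d x" and h = ?h and c = 0
      and g = "\<lambda>m. g (later_children S + m)", OF step]
    by simp
  show ?thesis
    using first rest unfolding Ts by (simp add: comp_def algebra_simps)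
qed

lemma sum_later_children_graft:
  fixes g :: "nat \<Rightarrow> int"
  assumes "1 \<le> d" and "dary d T"
  shows "(\<Sum>T'\<leftarrow>graft d x T. g (later_children T')) =
    int (later_children T + 1) * g (later_children T)
    + (int (length (graft d x T)) - int (later_children T + 1)) * g (Suc (later_children T))"
  using assms(2)
proof (induction T arbitrary: g)
  case External
  have "later_children (Node x (replicate d External)) = 0"
    by (cases d) (auto simp: sum_list_triv map_replicate)
  then show ?case by simp
next
  case (Node v Ts)
  then show ?case using assms(1) by (intro sum_later_children_graft_Node) auto
qed

section \<open>Forests grow by grafting\<close>

text \<open>The shape of the trees of a forest, kept apart from the conditions on labels, because grafting
  and pruning below the root preserve it for trivial reasons.\<close>

definition planted :: "nat \<Rightarrow> nat \<Rightarrow> itree \<Rightarrow> bool" where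
  "planted d u T \<longleftrightarrow> (\<exists>Ts. T = Node 0 Ts \<and> length Ts = u \<and> (\<forall>S\<in>set Ts. dary d S))"

lemma plantedE:
  assumes "planted d u T"
  obtains Ts where "T = Node 0 Ts" "length Ts = u" "\<forall>S\<in>set Ts. dary d S"
  using assms unfolding planted_def by blast

lemma sum_add_mset: "(\<Sum>i<m::nat. add_mset a (M i)) = replicate_mset m a + (\<Sum>i<m. M i)"
  by (induction m) auto

lemma mset_set_UN_disjoint:
  assumes "finite I" and "\<And>i. i \<in> I \<Longrightarrow> finite (X i)" and "disjoint_family_on X I"
  shows "mset_set (\<Union>i\<in>I. X i) = (\<Sum>i\<in>I. mset_set (X i))"
  using assms
proof (induction I rule: finite_induct)
  case (insert i I)
  then have "X i \<inter> (\<Union>i\<in>I. X i) = {}" and "disjoint_family_on X I"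
    by (auto simp: disjoint_family_on_def)
  then show ?case using insert by (simp add: mset_set_Union)
qed simp

lemma mset_labels_increasing_trees:
  assumes "T \<in> increasing_trees d u X" and "0 \<notin> X"
  shows "mset (labels T) = add_mset 0 (mset_set X)"
proof -
  have "finite X" "mset (labels T) = mset_set ({0} \<union> X)"
    using assms(1) by (auto simp: increasing_trees_def mset_set_set[symmetric] intro: finite_subset)
  then show ?thesis using assms(2) by simp
qed

text \<open>Replaces the unknown ordered partition by one equation between multisets: the root label occurs
  once per tree and each of \<open>1, \<dots>, n\<close> once altogether. This is the form in which the effect of a graft,
  adding one label, can be read off directly.\<close>

lemma increasing_forests_iff:
  "F \<in> increasing_forests d us n \<longleftrightarrow>
    list_all2 (planted d) us F \<and> (\<forall>T\<in>set F. heap_ordered T)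
    \<and> mset (concat (map labels F)) = replicate_mset (length us) 0 + mset_set {1..n}"
  (is "?L \<longleftrightarrow> ?R")
proof
  assume ?L
  then obtain X where len: "length F = length us" and X: "(\<Union>i<length us. X i) = {1..n}"
    "disjoint_family_on X {..<length us}"
    and F: "\<And>i. i < length us \<Longrightarrow> F ! i \<in> increasing_trees d (us ! i) (X i)"
    unfolding increasing_forests_def by auto
  have X0: "0 \<notin> X i" "finite (X i)" if "i < length us" for i
  proof -
    have "X i \<subseteq> {1..n}" using X that by blast
    then show "0 \<notin> X i" "finite (X i)" by (auto intro: finite_subset)
  qed
  have "mset (concat (map labels F)) = (\<Sum>i<length us. mset (labels (F ! i)))"
    by (simp add: mset_concat comp_def sum_list_sum_nth len atLeast0LessThan)
  also have "\<dots> = (\<Sum>i<length us. add_mset 0 (mset_set (X i)))"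
    using mset_labels_increasing_trees[OF F X0(1)] by (intro sum.cong) auto
  also have "\<dots> = replicate_mset (length us) 0 + mset_set {1..n}"
    using X X0 mset_set_UN_disjoint[of "{..<length us}" X]
    by (simp add: sum_add_mset)
  finally have "mset (concat (map labels F)) = replicate_mset (length us) 0 + mset_set {1..n}" .
  moreover have "list_all2 (planted d) us F"
    using F len by (auto simp: list_all2_conv_all_nth planted_def increasing_trees_def)
  moreover have "\<forall>T\<in>set F. heap_ordered T"
    using F len by (auto simp: in_set_conv_nth increasing_trees_def increasing_iff_heap_ordered)
  ultimately show ?R by blast
next
  assume R: ?R
  then have len: "length F = length us" by (auto dest: list_all2_lengthD)
  \<comment> \<open>The labels other than the root label; each of \<open>1, \<dots>, n\<close> has total multiplicity one in the
    forest, which forces distinct labels in each tree and disjoint label sets.\<close>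
  define N where "N T = mset (tl (labels T))" for T
  have planted: "planted d (us ! i) (F ! i)" if "i < length us" for i
    using R that by (auto simp: list_all2_conv_all_nth)
  have labels: "mset (labels (F ! i)) = add_mset 0 (N (F ! i))" if "i < length us" for i
    using planted[OF that] by (auto simp: planted_def N_def)
  have "mset (concat (map labels F)) = (\<Sum>i<length us. mset (labels (F ! i)))"
    by (simp add: mset_concat comp_def sum_list_sum_nth len atLeast0LessThan)
  also have "\<dots> = (\<Sum>i<length us. add_mset 0 (N (F ! i)))"
    using labels by (intro sum.cong) auto
  also have "\<dots> = replicate_mset (length us) 0 + (\<Sum>i<length us. N (F ! i))"
    by (simp add: sum_add_mset)
  finally have N: "(\<Sum>i<length us. N (F ! i)) = mset_set {1..n}"
    using R by simp
  have total: "(\<Sum>i<length us. count (N (F ! i)) y) = of_bool (y \<in> {1..n})" for y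
    using arg_cong[OF N, of "\<lambda>M. count M y"] by (simp add: count_sum count_mset_set')
  define X where "X i = set_mset (N (F ! i))" for i
  have "(\<Union>i<length us. X i) = {1..n}"
    using arg_cong[OF N, of set_mset] by (simp add: set_mset_sum X_def)
  moreover have "disjoint_family_on X {..<length us}"
    unfolding disjoint_family_on_def
  proof (intro ballI impI)
    fix i j assume ij: "i \<in> {..<length us}" "j \<in> {..<length us}" "i \<noteq> j"
    have le: "count (N (F ! i)) y + count (N (F ! j)) y \<le> 1" for y
    proof -
      have "(\<Sum>l\<in>{i, j}. count (N (F ! l)) y) \<le> (\<Sum>l<length us. count (N (F ! l)) y)"
        using ij by (intro sum_mono2) auto
      then show ?thesis using total[of y] ij by (simp add: of_bool_def split: if_splits)
    qed
    have False if y: "y \<in> X i" "y \<in> X j" for y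
    proof -
      have "count (N (F ! i)) y > 0" "count (N (F ! j)) y > 0"
        using y by (simp_all add: X_def)
      then show False using le[of y] by linarith
    qed
    then show "X i \<inter> X j = {}" by blast
  qed
  moreover have "F ! i \<in> increasing_trees d (us ! i) (X i)" if i: "i < length us" for i
  proof -
    have X_sub: "X i \<subseteq> {1..n}"
      using \<open>(\<Union>i<length us. X i) = {1..n}\<close> i by blast
    have "count (N (F ! i)) y \<le> 1" for y
    proof -
      have "count (N (F ! i)) y \<le> (\<Sum>l<length us. count (N (F ! l)) y)"
        using i by (intro member_le_sum) auto
      then show ?thesis using total[of y] by (simp add: of_bool_def split: if_splits)
    qed
    then have count_le: "count (mset (tl (labels (F ! i)))) y \<le> 1" for y
      by (simp add: N_def)
    have "distinct (tl (labels (F ! i)))"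
      unfolding distinct_count_atmost_1
    proof
      fix y
      show "count (mset (tl (labels (F ! i)))) y = (if y \<in> set (tl (labels (F ! i))) then 1 else 0)"
        using count_le[of y] count_greater_zero_iff[of "mset (tl (labels (F ! i)))" y]
        by (auto simp del: count_greater_zero_iff)
    qed
    moreover obtain Ts where Ts: "F ! i = Node 0 Ts" "length Ts = us ! i" "\<forall>S\<in>set Ts. dary d S"
      using planted[OF i] by (rule plantedE)
    moreover have "X i = set (tl (labels (F ! i)))"
      by (simp add: X_def N_def)
    moreover have "heap_ordered (F ! i)"
      using R i len by simp
    ultimately show ?thesis
      using X_sub unfolding increasing_trees_def increasing_iff_heap_ordered by auto
  qed
  ultimately show ?L
    unfolding increasing_forests_def using len by blast
qed

lemma mset_labels_graft_forest:
  assumes "F' \<in> set (replace_one (graft d x) F)"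
  shows "mset (concat (map labels F')) = add_mset x (mset (concat (map labels F)))"
  using assms by (auto simp: in_set_replace_one_iff mset_labels_graft)

lemma planted_graft:
  assumes "T' \<in> set (graft d x T)" and "planted d u T"
  shows "planted d u T'"
proof -
  obtain Ts where Ts: "T = Node 0 Ts" "length Ts = u" "\<forall>S\<in>set Ts. dary d S"
    using assms(2) by (rule plantedE)
  then show ?thesis
    using assms(1) dary_graft by (auto simp: planted_def in_set_replace_one_iff)
qed

lemma graft_forest_in_increasing_forests:
  assumes "F \<in> increasing_forests d us n" and "F' \<in> set (replace_one (graft d (Suc n)) F)"
  shows "F' \<in> increasing_forests d us (Suc n)"
proof -
  note F = assms(1)[unfolded increasing_forests_iff]
  obtain As T T' Bs where *: "F = As @ T # Bs" "T' \<in> set (graft d (Suc n) T)" "F' = As @ T' # Bs"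
    using assms(2) by (auto simp: in_set_replace_one_iff)
  have "set (concat (map labels F)) \<subseteq> {0..n}"
    using F by (auto simp flip: set_mset_mset simp del: set_concat split: if_splits)
  then have "heap_ordered T'"
    using F * by (intro heap_ordered_graft[OF *(2)]) (auto simp: less_Suc_eq_le)
  then have "\<forall>T\<in>set F'. heap_ordered T"
    using F * by auto
  moreover have "list_all2 (planted d) us F'"
    using F planted_graft[OF *(2)] unfolding *(1,3)
    by (auto simp: list_all2_conv_all_nth nth_append nth_Cons' split: if_splits)
  moreover have "mset (concat (map labels F')) = replicate_mset (length us) 0 + mset_set {1..Suc n}"
    using F mset_labels_graft_forest[OF assms(2)] by (simp add: atLeastAtMostSuc_conv)
  ultimately show ?thesis
    by (simp add: increasing_forests_iff)
qed

lemma in_graft_prune_forest: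
  assumes "F' \<in> increasing_forests d us (Suc n)"
  shows "F' \<in> set (replace_one (graft d (Suc n)) (map (prune (Suc n)) F'))"
proof (rule in_graft_forest_prune)
  note F = assms[unfolded increasing_forests_iff]
  show "count (mset (concat (map labels F'))) (Suc n) = 1"
    using F by simp
  have le: "set (concat (map labels F')) \<subseteq> {0..Suc n}"
    using F by (auto simp flip: set_mset_mset simp del: set_concat split: if_splits)
  fix T assume T: "T \<in> set F'" "count (mset (labels T)) (Suc n) = 1"
  then obtain u where "planted d u T"
    using F by (auto simp: list_all2_conv_all_nth in_set_conv_nth)
  then obtain Ts where Ts: "T = Node 0 Ts" "\<forall>S\<in>set Ts. dary d S"
    by (rule plantedE)
  have "Ts \<in> set (replace_one (graft d (Suc n)) (map (prune (Suc n)) Ts))"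
    using T Ts F le by (intro in_graft_forest_prune in_graft_prune) fastforce+
  then show "T \<in> set (graft d (Suc n) (prune (Suc n) T))"
    using Ts by simp
qed

lemma prune_in_increasing_forests:
  assumes "F' \<in> increasing_forests d us (Suc n)"
  shows "map (prune (Suc n)) F' \<in> increasing_forests d us n"
proof -
  note F = assms[unfolded increasing_forests_iff]
  have "planted d u T \<Longrightarrow> planted d u (prune (Suc n) T)" for u T
    by (auto simp: planted_def dary_prune)
  then have "list_all2 (planted d) us (map (prune (Suc n)) F')"
    using F by (auto simp: list_all2_map2 elim: list_all2_mono)
  moreover have "mset (concat (map labels (map (prune (Suc n)) F')))
      = replicate_mset (length us) 0 + mset_set {1..n}"
    using F mset_labels_graft_forest[OF in_graft_prune_forest[OF assms]]
    by (simp add: atLeastAtMostSuc_conv)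
  ultimately show ?thesis
    using F by (auto simp: increasing_forests_iff heap_ordered_prune)
qed

text \<open>The growth process: the vertex \<open>Suc n\<close> is grafted last.\<close>

lemma increasing_forests_Suc:
  "increasing_forests d us (Suc n) =
    (\<Union>F\<in>increasing_forests d us n. set (replace_one (graft d (Suc n)) F))"
proof (intro subset_antisym subsetI)
  fix F' assume "F' \<in> increasing_forests d us (Suc n)"
  then show "F' \<in> (\<Union>F\<in>increasing_forests d us n. set (replace_one (graft d (Suc n)) F))"
    using prune_in_increasing_forests in_graft_prune_forest by (intro UN_I)
qed (auto intro: graft_forest_in_increasing_forests)

lemma prune_graft_forest:
  assumes "F \<in> increasing_forests d us n" and "F' \<in> set (replace_one (graft d (Suc n)) F)"
  shows "map (prune (Suc n)) F' = F"
proof -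
  have "Suc n \<notin> set_mset (mset (concat (map labels F)))"
    using assms(1)[unfolded increasing_forests_iff] by (auto split: if_splits)
  then have "\<forall>T\<in>set F. Suc n \<notin> set (labels T)"
    by auto
  then show ?thesis
    using assms(2) by (auto simp: in_set_replace_one_iff prune_graft prune_fresh intro!: map_idI)
qed

lemma increasing_forests_0:
  "increasing_forests d us 0 = {map (\<lambda>u. Node 0 (replicate u External)) us}" (is "_ = {?F}")
proof (intro set_eqI iffI)
  fix F assume "F \<in> increasing_forests d us 0"
  then obtain X where len: "length F = length us" and X: "(\<Union>i<length us. X i) = {}"
    and F: "\<And>i. i < length us \<Longrightarrow> F ! i \<in> increasing_trees d (us ! i) (X i)"
    unfolding increasing_forests_def by auto
  have "F ! i = Node 0 (replicate (us ! i) External)" if i: "i < length us" for i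
  proof -
    have "X i = {}" using X i by blast
    then obtain Ts where Ts: "F ! i = Node 0 Ts" "length Ts = us ! i" "distinct (labels (F ! i))"
      "set (labels (F ! i)) = {0}"
      using F[OF i] by (auto simp: increasing_trees_def)
    then have "set (concat (map labels Ts)) \<subseteq> {0}" "0 \<notin> set (concat (map labels Ts))"
      by auto
    then have "concat (map labels Ts) = []"
      by (metis set_empty subset_singletonD insertI1)
    then have "\<forall>S\<in>set Ts. S = External"
      by simp
    then show ?thesis
      using Ts by (metis replicate_eqI)
  qed
  then show "F \<in> {?F}"
    using len by (simp add: list_eq_iff_nth_eq)
next
  fix F assume F: "F \<in> {?F}"
  have "labels (Node 0 (replicate u External)) = [0]" for u
    by simp
  then have "mset (concat (map labels ?F)) = replicate_mset (length us) 0"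
    by (induction us) simp_all
  moreover have "list_all2 (planted d) us ?F"
    by (auto simp: list_all2_conv_all_nth planted_def)
  ultimately show "F \<in> increasing_forests d us 0"
    using F by (simp add: increasing_forests_iff)
qed

lemma finite_increasing_forests: "finite (increasing_forests d us n)"
  by (induction n) (auto simp: increasing_forests_0 increasing_forests_Suc)

lemma sum_increasing_forests_Suc:
  fixes f :: "itree list \<Rightarrow> 'a :: comm_monoid_add"
  shows "(\<Sum>F\<in>increasing_forests d us (Suc n). f F) =
    (\<Sum>F\<in>increasing_forests d us n. \<Sum>F'\<leftarrow>replace_one (graft d (Suc n)) F. f F')"
proof -
  have "(\<Sum>F\<in>increasing_forests d us (Suc n). f F) =
      (\<Sum>F\<in>increasing_forests d us n. \<Sum>F'\<in>set (replace_one (graft d (Suc n)) F). f F')"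
    unfolding increasing_forests_Suc
  proof (intro sum.UNION_disjoint finite_increasing_forests ballI impI)
    fix F G assume "F \<in> increasing_forests d us n" "G \<in> increasing_forests d us n" "F \<noteq> G"
    then show "set (replace_one (graft d (Suc n)) F) \<inter> set (replace_one (graft d (Suc n)) G) = {}"
      using prune_graft_forest by (metis disjoint_iff)
  qed simp
  moreover have "distinct (replace_one (graft d (Suc n)) F)" for F
    using distinct_graft not_in_graft by (intro distinct_replace_one) blast
  ultimately show ?thesis
    by (simp add: sum.distinct_set_conv_list)
qed

section \<open>Statistics of forests\<close>

text \<open>The term \<open>d - 1\<close> on the left corrects for the root, which has \<open>u\<close> positions instead of \<open>d\<close>; adding
  it avoids a truncated subtraction.\<close>

lemma length_graft_planted:
  assumes "1 \<le> d" and "planted d u T"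
  shows "length (graft d x T) + (d - 1) = (d - 1) * length (labels T) + u"
proof -
  obtain Ts where Ts: "T = Node 0 Ts" "length Ts = u" "\<forall>S\<in>set Ts. dary d S"
    using assms(2) by (rule plantedE)
  have "length (graft d x T) = (\<Sum>S\<leftarrow>Ts. (d - 1) * length (labels S) + 1)"
    using Ts length_graft_dary[OF assms(1)]
    by (auto simp: length_replace_one intro!: arg_cong[where f = sum_list])
  then show ?thesis
    using Ts by (simp add: sum_list_Suc sum_list_const_mult length_concat comp_def)
qed

lemma length_graft_forest:
  assumes "1 \<le> d" and "F \<in> increasing_forests d us n"
  shows "length (replace_one (graft d x) F) = (d - 1) * n + sum_list us"
proof -
  note F = assms(2)[unfolded increasing_forests_iff]
  have "size (mset (concat (map labels F))) = length us + n"
    using F by simp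
  then have size: "(\<Sum>T\<leftarrow>F. length (labels T)) = length us + n"
    by (simp add: length_concat comp_def)
  have "list_all2 (planted d) us F" using F by blast
  then have "(\<Sum>T\<leftarrow>F. length (graft d x T)) + (d - 1) * length us
      = (d - 1) * (\<Sum>T\<leftarrow>F. length (labels T)) + sum_list us"
  proof (induction rule: list_all2_induct)
    case (Cons u us T F)
    then show ?case
      using length_graft_planted[OF assms(1) Cons.hyps(1), of x] by (simp add: distrib_left)
  qed simp
  then show ?thesis
    by (simp add: length_replace_one size distrib_left)
qed

lemma forest_ascents_eq:
  assumes "2 \<le> d" and "F \<in> increasing_forests d us n"
  shows "forest_ascents F = (\<Sum>T\<leftarrow>F. later_children T)"
proof -
  note F = assms(2)[unfolded increasing_forests_iff]
  have "tree_ascents T = later_children T" if T: "T \<in> set F" for T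
  proof -
    obtain u where "planted d u T"
      using F T by (auto simp: list_all2_conv_all_nth in_set_conv_nth)
    then obtain Ts where "T = Node 0 Ts" "\<forall>S\<in>set Ts. dary d S"
      by (rule plantedE)
    then show ?thesis
      using F T assms(1) word_ascents_Node[OF assms(1), of Ts 0] word_ascents_dary[OF assms(1)]
      by (auto simp: tree_ascents_def simp flip: word_ascents_def)
  qed
  then show ?thesis
    unfolding forest_ascents_def by (intro arg_cong[where f = sum_list]) auto
qed

text \<open>If \<open>u = 0\<close>, the root of the tree left after deleting \<open>0\<close> is exactly the first child of \<open>0\<close>, so
  the two cases in the definition of \<open>\<D>\<close> agree.\<close>

lemma tree_D_planted: "planted d (u + 1) T \<Longrightarrow> tree_D u T = first_children T"
  by (auto simp: tree_D_def length_Suc_conv elim!: plantedE)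

lemma card_forest_D:
  assumes "F \<in> increasing_forests d (map (\<lambda>u. u + 1) ts) n"
  shows "card (forest_D ts F) + (\<Sum>T\<leftarrow>F. later_children T) = n"
proof -
  let ?I = "{..<length ts}"
  obtain X where len: "length F = length ts" and X: "(\<Union>i\<in>?I. X i) = {1..n}"
    and disj: "disjoint_family_on X ?I"
    and F: "\<And>i. i \<in> ?I \<Longrightarrow> F ! i \<in> increasing_trees d (ts ! i + 1) (X i)"
    using assms unfolding increasing_forests_def by auto
  have tree: "tree_D (ts ! i) (F ! i) \<subseteq> X i \<and> finite (X i) \<and>
      card (tree_D (ts ! i) (F ! i)) + later_children (F ! i) = card (X i)" if i: "i \<in> ?I" for i
  proof -
    have "X i \<subseteq> {1..n}" using X i by blast
    then have "0 \<notin> X i" "finite (X i)" by (auto intro: finite_subset)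
    obtain Ts where Ts: "F ! i = Node 0 Ts" "planted d (ts ! i + 1) (F ! i)"
      and labels: "distinct (labels (F ! i))" "set (labels (F ! i)) = {0} \<union> X i"
      using F[OF i] by (auto simp: increasing_trees_def planted_def)
    have "set (tl (labels (F ! i))) = X i"
      using labels \<open>0 \<notin> X i\<close> unfolding Ts(1) labels.simps distinct.simps list.sel list.set
      by (metis Diff_insert_absorb insert_is_Un)
    moreover have "length (labels (F ! i)) = Suc (card (X i))"
      using distinct_card[OF labels(1)] labels(2) \<open>0 \<notin> X i\<close> \<open>finite (X i)\<close> by simp
    ultimately show ?thesis
      using tree_D_planted[OF Ts(2)] first_children_subset[of "F ! i"]
        card_first_children[OF labels(1)] Ts(1) \<open>finite (X i)\<close> by simp
  qed
  have "card (forest_D ts F) = (\<Sum>i\<in>?I. card (tree_D (ts ! i) (F ! i)))"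
    unfolding forest_D_def
    using tree disj by (intro card_UN_disjoint)
      (auto simp: disjoint_family_on_def intro: finite_subset, blast)
  moreover have "(\<Sum>T\<leftarrow>F. later_children T) = (\<Sum>i\<in>?I. later_children (F ! i))"
    by (simp add: sum_list_sum_nth len atLeast0LessThan)
  moreover have "(\<Sum>i\<in>?I. card (X i)) = card (\<Union>i\<in>?I. X i)"
    using tree disj by (intro card_UN_disjoint[symmetric]) (auto simp: disjoint_family_on_def)
  ultimately show ?thesis
    using X tree by (simp flip: sum.distrib)
qed

text \<open>Each tree of the forest has one position more than its number of ascents at which a graft keeps
  that number, hence the shift by the number of trees.\<close>

lemma sum_later_children_graft_forest:
  fixes g :: "nat \<Rightarrow> int"
  assumes "1 \<le> d" and "F \<in> increasing_forests d us n" and "\<forall>u\<in>set us. 1 \<le> u"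
  defines "j \<equiv> \<Sum>T\<leftarrow>F. later_children T"
  shows "(\<Sum>F'\<leftarrow>replace_one (graft d x) F. g (\<Sum>T\<leftarrow>F'. later_children T)) =
    int (j + length us) * g j
    + (int ((d - 1) * n + sum_list us) - int (j + length us)) * g (Suc j)"
proof -
  note F = assms(2)[unfolded increasing_forests_iff]
  have "length F = length us" using F by (auto dest: list_all2_lengthD)
  have "(\<Sum>T'\<leftarrow>graft d x T. g (later_children T')) =
      int (later_children T + 1) * g (later_children T)
      + (int (length (graft d x T)) - int (later_children T + 1)) * g (Suc (later_children T))"
    if T: "T \<in> set F" for T g
  proof -
    obtain u where "planted d u T" "1 \<le> u"
      using F T assms(3) by (fastforce simp: list_all2_conv_all_nth in_set_conv_nth)
    then obtain Ts where Ts: "T = Node 0 Ts" "length Ts = u" "\<forall>S\<in>set Ts. dary d S"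
      by (elim plantedE)
    then have "Ts \<noteq> []" using \<open>1 \<le> u\<close> by auto
    with Ts show ?thesis
      using sum_later_children_graft_Node sum_later_children_graft[OF assms(1)] by blast
  qed
  from sum_list_replace_one[where h = later_children and c = 1 and g = g, OF this]
  show ?thesis
    using \<open>length F = length us\<close> length_graft_forest[OF assms(1,2)] by (simp add: j_def)
qed

section \<open>The Ward recurrence\<close>

text \<open>The number of ways to distinguish \<open>n - k\<close> of the \<open>n - j\<close> first children of a forest on \<open>{1..n}\<close> with
  \<open>j\<close> ascents. The lower index is the complementary \<open>k - j\<close>, so that the value is also
  correct, namely \<open>0\<close>, for \<open>k > n\<close>; such \<open>k\<close> occur in the recurrence.\<close>

definition pair_weight :: "nat \<Rightarrow> nat \<Rightarrow> nat \<Rightarrow> int" where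
  "pair_weight n k j = (if j \<le> k then int ((n - j) choose (k - j)) else 0)"

lemma Suc_times_binomial_Suc:
  "(int m + 1) * int (N choose Suc m) = (int N - int m) * int (N choose m)"
proof (cases "m \<le> N")
  case True
  have "Suc m * (N choose Suc m) = (N - m) * (N choose m)"
    using binomial_absorption[of m N] binomial_absorb_comp[of N m] by simp
  then have "int (Suc m * (N choose Suc m)) = int ((N - m) * (N choose m))"
    by simp
  then show ?thesis using True by (simp add: of_nat_diff algebra_simps)
qed (simp add: binomial_eq_0)

text \<open>Here and in the next lemma \<open>e\<close> stands for the number of external positions and \<open>s\<close> for the number of
  trees; the left side is the total weight of all grafts of one forest with \<open>j\<close> ascents.\<close>

lemma pair_weight_0:
  "(int j + s) * pair_weight (Suc n) 0 j + (e - (int j + s)) * pair_weight (Suc n) 0 (Suc j) =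
    s * pair_weight n 0 j"
  by (simp add: pair_weight_def)

text \<open>With \<open>N = n - j\<close> and \<open>m = k - j\<close>, Pascal's rule reduces the claim to
  \<open>(m + 1) (N choose m + 1) = (N - m) (N choose m)\<close>.\<close>

lemma pair_weight_Suc:
  assumes "j \<le> n"
  shows "(int j + s) * pair_weight (Suc n) (Suc k) j
      + (e - (int j + s)) * pair_weight (Suc n) (Suc k) (Suc j) =
    (int k + 1 + s) * pair_weight n (Suc k) j + (e - int n + int k) * pair_weight n k j"
proof -
  consider "Suc k < j" | "j = Suc k" | "j \<le> k" by linarith
  then show ?thesis
  proof cases
    case 3
    define N m where "N = n - j" and "m = k - j"
    have "n = N + j" "k = m + j"
      using assms 3 by (auto simp: N_def m_def)
    then show ?thesis
      using Suc_times_binomial_Suc[of m N]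
      by (simp add: pair_weight_def Suc_diff_le algebra_simps)
  qed (auto simp: pair_weight_def)
qed

lemma ward_eq_0: "n < 0 \<or> k < 0 \<Longrightarrow> ward \<nu> n k s t = 0"
  by (subst ward.simps) simp

lemma ward_nat_0: "ward \<nu> 0 (int k) s t = pair_weight 0 k 0"
  by (subst ward.simps) (simp add: ward_eq_0 pair_weight_def)

lemma ward_Suc_0: "ward \<nu> (int (Suc n)) 0 s t = s * ward \<nu> (int n) 0 s t"
  by (subst ward.simps) (simp add: ward_eq_0)

lemma ward_Suc_Suc:
  "ward \<nu> (int (Suc n)) (int (Suc k)) s t =
    (int k + 1 + s) * ward \<nu> (int n) (int (Suc k)) s t
    + (\<nu> * int n + int k + s + t) * ward \<nu> (int n) (int k) s t"
  by (subst ward.simps) (simp add: algebra_simps)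

lemma ward_eq_sum_pair_weight:
  "ward (int \<nu>) (int n) (int k) (int (length ts)) (int (sum_list ts)) =
    (\<Sum>F\<in>increasing_forests (\<nu> + 2) (map (\<lambda>u. u + 1) ts) n.
      pair_weight n k (\<Sum>T\<leftarrow>F. later_children T))"
proof (induction n arbitrary: k)
  case 0
  have "later_children (Node 0 (replicate u External)) = 0" for u
    by (cases u) (auto simp: sum_list_triv map_replicate)
  then show ?case
    unfolding increasing_forests_0 of_nat_0 ward_nat_0 by (simp add: comp_def sum_list_replicate)
next
  case (Suc n)
  define e where "e = (int \<nu> + 1) * int n + int (sum_list ts) + int (length ts)"
  define s where "s = int (length ts)"
  let ?\<F> = "increasing_forests (\<nu> + 2) (map (\<lambda>u. u + 1) ts)"
  let ?j = "\<lambda>F. \<Sum>T\<leftarrow>F. later_children T"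
  have sum_Suc: "(\<Sum>F\<in>?\<F> (Suc n). pair_weight (Suc n) k (?j F)) =
      (\<Sum>F\<in>?\<F> n. (int (?j F) + s) * pair_weight (Suc n) k (?j F)
        + (e - (int (?j F) + s)) * pair_weight (Suc n) k (Suc (?j F)))" for k
    unfolding sum_increasing_forests_Suc
    by (intro sum.cong refl)
      (simp add: sum_later_children_graft_forest sum_list_Suc e_def s_def algebra_simps)
  show ?case
  proof (cases k)
    case 0
    then show ?thesis
      using Suc.IH[of 0] ward_Suc_0[of "int \<nu>" n s "int (sum_list ts)"] sum_Suc[of 0]
      by (simp add: pair_weight_0 sum_distrib_left s_def)
  next
    case k: (Suc k')
    have le: "?j F \<le> n" if "F \<in> ?\<F> n" for F
      using card_forest_D[OF that] by linarith
    have "(\<Sum>F\<in>?\<F> (Suc n). pair_weight (Suc n) k (?j F)) =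
        (\<Sum>F\<in>?\<F> n. (int k' + 1 + s) * pair_weight n (Suc k') (?j F)
          + (e - int n + int k') * pair_weight n k' (?j F))"
      unfolding sum_Suc k by (intro sum.cong refl pair_weight_Suc le)
    also have "\<dots> = (int k' + 1 + s) * ward (int \<nu>) (int n) (int (Suc k')) s (int (sum_list ts))
        + (e - int n + int k') * ward (int \<nu>) (int n) (int k') s (int (sum_list ts))"
      unfolding s_def Suc.IH by (simp add: sum.distrib sum_distrib_left)
    also have "e - int n + int k' = int \<nu> * int n + int k' + s + int (sum_list ts)"
      by (simp add: e_def s_def algebra_simps)
    finally show ?thesis
      unfolding k ward_Suc_Suc s_def by simp
  qed
qed

theorem theorem21:
  fixes n t \<nu> s k :: nat and ts :: "nat list"
  assumes "\<nu> \<ge> 1" and "s \<ge> 1" and "k \<le> n"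
    and "length ts = s" and "sum_list ts = t"
  shows "ward (int \<nu>) (int n) (int k) (int s) (int t) =
    int (card {(F, S). F \<in> increasing_forests (\<nu> + 2) (map (\<lambda>u. u + 1) ts) n
      \<and> forest_ascents F \<le> k \<and> S \<subseteq> forest_D ts F \<and> card S = n - k})"
proof -
  let ?\<F> = "increasing_forests (\<nu> + 2) (map (\<lambda>u. u + 1) ts) n"
  let ?\<G> = "{F \<in> ?\<F>. forest_ascents F \<le> k}"
  let ?S = "\<lambda>F. {S. S \<subseteq> forest_D ts F \<and> card S = n - k}"
  have asc: "forest_ascents F = (\<Sum>T\<leftarrow>F. later_children T)" if "F \<in> ?\<F>" for F
    using forest_ascents_eq that by (metis le_add2)
  have fin_D: "finite (forest_D ts F)" for F
    by (simp add: forest_D_def tree_D_def)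
  have card_S: "int (card (?S F)) = pair_weight n k (\<Sum>T\<leftarrow>F. later_children T)" if "F \<in> ?\<G>" for F
  proof -
    let ?j = "\<Sum>T\<leftarrow>F. later_children T"
    have "F \<in> ?\<F>" "?j \<le> k" using that asc by auto
    then have D: "card (forest_D ts F) = n - ?j"
      using card_forest_D[of F] by fastforce
    have "card (?S F) = (n - ?j) choose (n - k)"
      using n_subsets[OF fin_D] D by simp
    also have "\<dots> = (n - ?j) choose (k - ?j)"
      using \<open>?j \<le> k\<close> \<open>k \<le> n\<close> binomial_symmetric[of "k - ?j" "n - ?j"] by simp
    finally show ?thesis
      using \<open>?j \<le> k\<close> by (simp add: pair_weight_def)
  qed
  have pairs: "{(F, S). F \<in> ?\<F> \<and> forest_ascents F \<le> k \<and> S \<subseteq> forest_D ts F \<and> card S = n - k}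
      = Sigma ?\<G> ?S"
    by auto
  have card_pairs: "card (Sigma ?\<G> ?S) = (\<Sum>F\<in>?\<G>. card (?S F))"
  proof (rule card_SigmaI)
    show "finite ?\<G>" by (simp add: finite_increasing_forests)
    have "?S F \<subseteq> Pow (forest_D ts F)" for F by blast
    then show "\<forall>F\<in>?\<G>. finite (?S F)"
      using fin_D by (meson finite_Pow_iff finite_subset)
  qed
  have "int (card (Sigma ?\<G> ?S)) = (\<Sum>F\<in>?\<G>. pair_weight n k (\<Sum>T\<leftarrow>F. later_children T))"
    unfolding card_pairs of_nat_sum by (intro sum.cong refl card_S)
  also have "\<dots> = (\<Sum>F\<in>?\<F>. pair_weight n k (\<Sum>T\<leftarrow>F. later_children T))"
    by (intro sum.mono_neutral_left) (auto simp: finite_increasing_forests asc pair_weight_def)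
  also have "\<dots> = ward (int \<nu>) (int n) (int k) (int s) (int t)"
    using ward_eq_sum_pair_weight[of \<nu> n k ts] assms(4,5) by simp
  finally show ?thesis
    unfolding pairs by (rule sym)
qed

end
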